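(* Let $(X,\gamma)$ be a generalized Minkowski space and let $P=\{p_1,\ldots,p_n\}\subseteq X$ be a set of $n\ge 1$ distinct points. Suppose that $\bar{x}\in\mathrm{ft}(P)\setminus P$, and for each $i\in\{1,\ldots,n\}$ let $\phi_i$ be a $\gamma$-norming functional of $p_i-\bar{x}$ such that $\sum_{i=1}^n\phi_i=0$. Then $$\mathrm{ft}(P)=\bigcap_{i=1}^n C(p_i,\phi_i).$$
   Context: $X$ is a finite-dimensional real vector space. A gauge on $X$ is a function $\gamma:X\to[0,+\infty)$ such that $\gamma(x)=0$ implies $x=0$; $\gamma(\lambda x)=\lambda\gamma(x)$ for all $x\in X$, $\lambda\ge 0$; and $\gamma(x+y)\le\gamma(x)+\gamma(y)$ for all $x,y\in X$ (no symmetry is assumed). The pair $(X,\gamma)$ is called a generalized Minkowski space. $X^\ast$ is the space of linear functionals on $X$, and $\langle\phi\mid x\rangle$ denotes $\phi(x)$. The polar function of $\gamma$ is $\gamma^\circ:X^\ast\to[0,+\infty)$, $\gamma^\circ(\phi)=\inf\{\lambda>0:\langle\phi\mid x\rangle\le\lambda\gamma(x)\text{ for all }x\in X\}$. A functional $\phi\in X^\ast$ is a $\gamma$-norming functional of $x\in X$ if $\gamma^\circ(\phi)=1$ and $\langle\phi\mid x\rangle=\gamma(x)$. For a finite set $P=\{p_1,\ldots,p_n\}$ of $n$ distinct points, $\mathrm{ft}(P)$ (the Fermat--Torricelli locus) is the set of all minimizers over $X$ of $x\mapsto\sum_{i=1}^n\gamma(p_i-x)$. For $\phi\in X^\ast$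 with $\gamma^\circ(\phi)=1$ and $x\in X$, $C(x,\phi)=x-\{z\in X:\langle\phi\mid z\rangle=\gamma(z)\}$. *)

theory Defs
  imports "HOL-Analysis.Analysis"
begin

text \<open>
  A generalized Minkowski space is a finite-dimensional real vector space with a gauge. No norm,
  inner product or topology is assumed: the space is a type of class \<^class>\<open>real_vector\<close>, and
  finite-dimensionality is an explicit hypothesis. (\<open>Minkowski_gauge\<close> is unrelated to the
  library's \<^const>\<open>gauge\<close> of Henstock--Kurzweil integration.)
\<close>

definition finite_dim_space :: "'a::real_vector itself \<Rightarrow> bool" where
  "finite_dim_space _ \<longleftrightarrow> (\<exists>B::'a set. finite B \<and> span B = UNIV)"

definition Minkowski_gauge :: "('a::real_vector \<Rightarrow> real) \<Rightarrow> bool" where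
  "Minkowski_gauge \<gamma> \<longleftrightarrow>
     (\<forall>x. 0 \<le> \<gamma> x) \<and>
     (\<forall>x. \<gamma> x = 0 \<longrightarrow> x = 0) \<and>
     (\<forall>x. \<forall>c\<ge>0. \<gamma> (c *\<^sub>R x) = c * \<gamma> x) \<and>
     (\<forall>x y. \<gamma> (x + y) \<le> \<gamma> x + \<gamma> y)"

definition generalized_Minkowski_space :: "('a::real_vector \<Rightarrow> real) \<Rightarrow> bool" where
  "generalized_Minkowski_space \<gamma> \<longleftrightarrow> finite_dim_space TYPE('a) \<and> Minkowski_gauge \<gamma>"

text \<open>
  Functionals are functions \<open>\<phi>\<close> with \<^term>\<open>linear \<phi>\<close>. For these, in a generalized Minkowski space,
  the set in the next definition is nonempty and bounded below, so the infimum is the genuine one.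
\<close>

definition polar_function :: "('a::real_vector \<Rightarrow> real) \<Rightarrow> ('a \<Rightarrow> real) \<Rightarrow> real" where
  "polar_function \<gamma> \<phi> = Inf {c. 0 < c \<and> (\<forall>x. \<phi> x \<le> c * \<gamma> x)}"

definition norming_functional ::
    "('a::real_vector \<Rightarrow> real) \<Rightarrow> ('a \<Rightarrow> real) \<Rightarrow> 'a \<Rightarrow> bool" where
  "norming_functional \<gamma> \<phi> x \<longleftrightarrow> linear \<phi> \<and> polar_function \<gamma> \<phi> = 1 \<and> \<phi> x = \<gamma> x"

definition Fermat_Torricelli_locus :: "('a::real_vector \<Rightarrow> real) \<Rightarrow> 'a set \<Rightarrow> 'a set" where
  "Fermat_Torricelli_locus \<gamma> P =
     {x. \<forall>y. (\<Sum>p\<in>P. \<gamma> (p - x)) \<le> (\<Sum>p\<in>P. \<gamma> (p - y))}"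

definition norming_cone ::
    "('a::real_vector \<Rightarrow> real) \<Rightarrow> 'a \<Rightarrow> ('a \<Rightarrow> real) \<Rightarrow> 'a set" where
  "norming_cone \<gamma> x \<phi> = (\<lambda>z. x - z) ` {z. \<phi> z = \<gamma> z}"

end

theory Submission
  imports Defs
begin

text \<open>
  The inequality \<open>\<phi> x \<le> \<gamma>\<^sup>\<circ>(\<phi>) \<gamma> x\<close> bounds the Fermat--Torricelli objective from below: if
  \<open>\<gamma>\<^sup>\<circ>(\<phi>\<^sub>i) = 1\<close> for all \<open>i\<close>, then
  \<open>\<Sum>\<gamma>(p\<^sub>i - y) \<ge> \<Sum>\<phi>\<^sub>i(p\<^sub>i - y) = \<Sum>\<phi>\<^sub>i(p\<^sub>i)\<close>, where the last step holds because the \<open>\<phi>\<^sub>i\<close> sum to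
  zero. The bound does not depend on \<open>y\<close>, and it is attained at \<open>xbar\<close>, where every \<open>\<phi>\<^sub>i\<close> is
  norming; it is therefore the minimum. A point \<open>y\<close> is then a minimizer if and only if the sum of the
  inequalities \<open>\<phi>\<^sub>i(p\<^sub>i - y) \<le> \<gamma>(p\<^sub>i - y)\<close> is an equality, which happens if and only if each of
  them is one, and this says that \<open>y\<close> lies in every cone \<open>C(p\<^sub>i, \<phi>\<^sub>i)\<close>.

  The inequality for the polar function is meaningful only if some multiple of \<open>\<gamma>\<close> dominates \<open>\<phi>\<close>,
  for otherwise the infimum defining \<open>\<gamma>\<^sup>\<circ>(\<phi>)\<close> is taken over the empty set. This is where finite
  dimension enters. In coordinates with respect to a basis, \<open>\<gamma>\<close> is continuous and positive on the
  compact \<open>\<ell>\<^sup>1\<close> unit sphere, so it is bounded below by a positive multiple of the \<open>\<ell>\<^sup>1\<close> norm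
  (\<open>gauge_coercive\<close>), and a linear functional is bounded above by a multiple of that norm.
\<close>

section \<open>Gauges in coordinates\<close>

lemma gauge_nonneg: "Minkowski_gauge \<gamma> \<Longrightarrow> 0 \<le> \<gamma> x"
  and gauge_eq_0D: "Minkowski_gauge \<gamma> \<Longrightarrow> \<gamma> x = 0 \<Longrightarrow> x = 0"
  and gauge_scaleR: "Minkowski_gauge \<gamma> \<Longrightarrow> 0 \<le> c \<Longrightarrow> \<gamma> (c *\<^sub>R x) = c * \<gamma> x"
  and gauge_triangle: "Minkowski_gauge \<gamma> \<Longrightarrow> \<gamma> (x + y) \<le> \<gamma> x + \<gamma> y"
  unfolding Minkowski_gauge_def by blast+

lemma gauge_0: "Minkowski_gauge \<gamma> \<Longrightarrow> \<gamma> 0 = 0"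
  using gauge_scaleR[of \<gamma> 0 0] by simp

text \<open>
  Without symmetry a negative coefficient is paid for by \<open>\<gamma> (- b)\<close> instead of \<open>\<gamma> b\<close>; the sum of
  the two covers both signs.
\<close>

lemma gauge_scaleR_le:
  assumes "Minkowski_gauge \<gamma>"
  shows "\<gamma> (c *\<^sub>R b) \<le> \<bar>c\<bar> * (\<gamma> b + \<gamma> (- b))"
proof (cases "0 \<le> c")
  case True
  then show ?thesis
    using gauge_scaleR[OF assms True, of b] gauge_nonneg[OF assms, of "- b"]
    by (simp add: distrib_left)
next
  case False
  then have "\<gamma> (c *\<^sub>R b) = - c * \<gamma> (- b)"
    using gauge_scaleR[OF assms, of "- c" "- b"] by simp
  then show ?thesis
    using False gauge_nonneg[OF assms, of b] by (simp add: distrib_left mult_nonpos_nonneg)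
qed

lemma gauge_sum_le:
  assumes "Minkowski_gauge \<gamma>"
  shows "\<gamma> (\<Sum>b\<in>B. f b *\<^sub>R b) \<le> (\<Sum>b\<in>B. \<bar>f b\<bar> * (\<gamma> b + \<gamma> (- b)))"
proof (induction B rule: infinite_finite_induct)
  case (insert b B)
  then show ?case
    using gauge_triangle[OF assms, of "f b *\<^sub>R b" "\<Sum>b\<in>B. f b *\<^sub>R b"]
      gauge_scaleR_le[OF assms, of "f b" b] by simp
qed (simp_all add: gauge_0[OF assms])

text \<open>
  Continuity is with respect to the product topology on \<open>'a \<Rightarrow> real\<close>, which serves as coordinate
  space for every finite \<open>B\<close>: only the finitely many coordinates in \<open>B\<close> matter.
\<close>

lemma continuous_on_gauge_coordinates:
  assumes "Minkowski_gauge \<gamma>"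
  shows "continuous_on UNIV (\<lambda>f. \<gamma> (\<Sum>b\<in>B. f b *\<^sub>R b))"
proof -
  let ?F = "\<lambda>f. \<gamma> (\<Sum>b\<in>B. f b *\<^sub>R b)"
  let ?d = "\<lambda>f g. \<Sum>b\<in>B. \<bar>f b - g b\<bar> * (\<gamma> b + \<gamma> (- b))"
  have le: "?F f \<le> ?F g + ?d f g" for f g :: "'a \<Rightarrow> real"
  proof -
    have "(\<Sum>b\<in>B. f b *\<^sub>R b) = (\<Sum>b\<in>B. g b *\<^sub>R b) + (\<Sum>b\<in>B. (f b - g b) *\<^sub>R b)"
      by (simp add: scaleR_left_diff_distrib sum_subtractf)
    then show ?thesis
      using gauge_triangle[OF assms, of "\<Sum>b\<in>B. g b *\<^sub>R b" "\<Sum>b\<in>B. (f b - g b) *\<^sub>R b"]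
        gauge_sum_le[OF assms, of "\<lambda>b. f b - g b" B] by simp
  qed
  have "(?F \<longlongrightarrow> ?F g) (at g)" for g
  proof (rule LIM_zero_cancel, rule Lim_null_comparison)
    show "\<forall>\<^sub>F f in at g. norm (?F f - ?F g) \<le> ?d f g"
    proof (rule always_eventually, rule allI)
      fix f
      have "?d g f = ?d f g"
        by (simp add: abs_minus_commute)
      then show "norm (?F f - ?F g) \<le> ?d f g"
        using le[of f g] le[of g f] by simp
    qed
    have "continuous_on UNIV (\<lambda>f. ?d f g)"
      by (intro continuous_intros continuous_on_product_coordinates)
    then have "((\<lambda>f. ?d f g) \<longlongrightarrow> ?d g g) (at g)"
      unfolding continuous_on_def by (rule bspec) simp
    then show "((\<lambda>f. ?d f g) \<longlongrightarrow> 0) (at g)"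
      by simp
  qed
  then show ?thesis
    by (simp add: continuous_on_def)
qed

text \<open>
  The minimum of \<open>\<gamma>\<close> over the \<open>\<ell>\<^sup>1\<close> unit sphere is the constant; it is positive because an
  independent family has no nontrivial combination equal to zero. Coordinates outside \<open>B\<close> are
  confined to \<open>[-1, 1]\<close> so that the sphere becomes compact by Tychonoff's theorem.
\<close>

lemma gauge_coercive:
  assumes \<gamma>: "Minkowski_gauge \<gamma>" and "finite B" and "independent B"
  shows "\<exists>m>0. \<forall>f. m * (\<Sum>b\<in>B. \<bar>f b\<bar>) \<le> \<gamma> (\<Sum>b\<in>B. f b *\<^sub>R b)"
proof (cases "B = {}")
  case True
  then show ?thesis
    using gauge_0[OF \<gamma>] by (auto intro: exI[of _ 1])
next
  case False
  let ?F = "\<lambda>f. \<gamma> (\<Sum>b\<in>B. f b *\<^sub>R b)"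
  let ?N = "\<lambda>f::'a \<Rightarrow> real. \<Sum>b\<in>B. \<bar>f b\<bar>"
  define K where "K = (UNIV \<rightarrow>\<^sub>E {-1..1}) \<inter> {f. ?N f = 1}"
  have "compactin (product_topology (\<lambda>_::'a. euclideanreal) UNIV) (UNIV \<rightarrow>\<^sub>E {-1..1})"
    by (subst compactin_PiE) simp
  then have "compact (UNIV \<rightarrow>\<^sub>E {-1..1} :: ('a \<Rightarrow> real) set)"
    by (simp add: euclidean_product_topology)
  moreover have "closed {f. ?N f = 1}"
    by (intro closed_Collect_eq continuous_intros continuous_on_product_coordinates)
  ultimately have "compact K"
    unfolding K_def by (rule compact_Int_closed)
  have in_K: "(\<lambda>b. if b \<in> B then f b / ?N f else 0) \<in> K" if "0 < ?N f" for f
  proof -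
    have "\<bar>f b\<bar> \<le> ?N f" if "b \<in> B" for b
      using that \<open>finite B\<close> by (intro member_le_sum) auto
    then have "\<bar>f b / ?N f\<bar> \<le> 1" if "b \<in> B" for b
      using that \<open>0 < ?N f\<close> by simp
    then have "\<forall>b\<in>B. - 1 \<le> f b / ?N f \<and> f b / ?N f \<le> 1"
      by (meson abs_le_iff minus_le_iff)
    moreover have "(\<Sum>b\<in>B. \<bar>f b / ?N f\<bar>) = 1"
    proof -
      have "(\<Sum>b\<in>B. \<bar>f b / ?N f\<bar>) = (\<Sum>b\<in>B. \<bar>f b\<bar> / ?N f)"
        using that by (intro sum.cong) (auto simp: abs_divide)
      also have "\<dots> = ?N f / ?N f"
        by (rule sum_divide_distrib[symmetric])
      finally show ?thesis
        using that by simp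
    qed
    ultimately show ?thesis
      by (auto simp: K_def)
  qed
  have "K \<noteq> {}"
    using in_K[of "\<lambda>_. 1"] False \<open>finite B\<close> by (auto simp: card_gt_0_iff)
  with \<open>compact K\<close> obtain g where "g \<in> K" and min: "\<And>f. f \<in> K \<Longrightarrow> ?F g \<le> ?F f"
    using continuous_attains_inf[of K ?F] continuous_on_gauge_coordinates[OF \<gamma>, of B]
    by (meson continuous_on_subset top_greatest)
  have "?F g \<noteq> 0"
  proof
    assume "?F g = 0"
    then have "(\<Sum>b\<in>B. g b *\<^sub>R b) = 0"
      by (rule gauge_eq_0D[OF \<gamma>])
    then have "\<forall>b\<in>B. g b = 0"
      using \<open>finite B\<close> \<open>independent B\<close> dependent_finite by blast
    with \<open>g \<in> K\<close> show False
      by (simp add: K_def)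
  qed
  then have "0 < ?F g"
    using gauge_nonneg[OF \<gamma>, of "\<Sum>b\<in>B. g b *\<^sub>R b"] by simp
  moreover have "?F g * ?N f \<le> ?F f" for f
  proof (cases "0 < ?N f")
    case True
    have "(\<Sum>b\<in>B. (if b \<in> B then f b / ?N f else 0) *\<^sub>R b) = (1 / ?N f) *\<^sub>R (\<Sum>b\<in>B. f b *\<^sub>R b)"
      by (simp add: scaleR_sum_right)
    then have "?F g \<le> ?F f / ?N f"
      using min[OF in_K[OF True]] gauge_scaleR[OF \<gamma>, of "1 / ?N f"] True by simp
    then show ?thesis
      using True by (simp add: pos_le_divide_eq)
  next
    case False
    then have "?N f = 0"
      using sum_nonneg[of B "\<lambda>b. \<bar>f b\<bar>"] by linarith
    then show ?thesis
      using gauge_nonneg[OF \<gamma>] by simp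
  qed
  ultimately show ?thesis
    by blast
qed

section \<open>The polar function\<close>

lemma linear_le_gauge:
  fixes \<gamma> :: "'a::real_vector \<Rightarrow> real"
  assumes "generalized_Minkowski_space \<gamma>" and "linear \<phi>"
  shows "\<exists>c>0. \<forall>x. \<phi> x \<le> c * \<gamma> x"
proof -
  have \<gamma>: "Minkowski_gauge \<gamma>"
    using assms(1) by (simp add: generalized_Minkowski_space_def)
  obtain S :: "'a set" where S: "finite S" "span S = UNIV"
    using assms(1) by (auto simp: generalized_Minkowski_space_def finite_dim_space_def)
  obtain B where B: "B \<subseteq> S" "independent B" "S \<subseteq> span B"
    using maximal_independent_subset by blast
  have "finite B"
    using B(1) S(1) by (rule finite_subset)
  have "span B = UNIV"
    using S(2) B(3) span_minimal[OF B(3) subspace_span] by auto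
  obtain m where "m > 0" and m: "\<And>f. m * (\<Sum>b\<in>B. \<bar>f b\<bar>) \<le> \<gamma> (\<Sum>b\<in>B. f b *\<^sub>R b)"
    using gauge_coercive[OF \<gamma> \<open>finite B\<close> B(2)] by blast
  \<comment> \<open>The summand 1 keeps the constant positive when \<open>\<phi>\<close> vanishes.\<close>
  define C where "C = 1 + (\<Sum>b\<in>B. \<bar>\<phi> b\<bar>)"
  have "C > 0"
    unfolding C_def by (intro add_pos_nonneg sum_nonneg) auto
  have "\<phi> x \<le> C / m * \<gamma> x" for x
  proof -
    have "x \<in> range (\<lambda>f. \<Sum>b\<in>B. f b *\<^sub>R b)"
      using \<open>span B = UNIV\<close> span_finite[OF \<open>finite B\<close>] by simp
    then obtain f where f: "x = (\<Sum>b\<in>B. f b *\<^sub>R b)"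
      by blast
    have "\<phi> x = (\<Sum>b\<in>B. f b * \<phi> b)"
      unfolding f by (simp add: linear_sum[OF assms(2)] linear_scale[OF assms(2)])
    also have "\<dots> \<le> (\<Sum>b\<in>B. \<bar>f b\<bar> * C)"
    proof (rule sum_mono)
      fix b assume "b \<in> B"
      then have "\<bar>\<phi> b\<bar> \<le> (\<Sum>b\<in>B. \<bar>\<phi> b\<bar>)"
        using \<open>finite B\<close> by (intro member_le_sum) auto
      then have "\<bar>\<phi> b\<bar> \<le> C"
        by (simp add: C_def)
      then have "\<bar>f b\<bar> * \<bar>\<phi> b\<bar> \<le> \<bar>f b\<bar> * C"
        by (intro mult_left_mono) auto
      then show "f b * \<phi> b \<le> \<bar>f b\<bar> * C"
        using abs_ge_self[of "f b * \<phi> b"] by (simp add: abs_mult)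
    qed
    also have "\<dots> = C / m * (m * (\<Sum>b\<in>B. \<bar>f b\<bar>))"
      using \<open>m > 0\<close> by (simp add: sum_distrib_left mult.commute)
    also have "\<dots> \<le> C / m * \<gamma> x"
      unfolding f using \<open>m > 0\<close> \<open>C > 0\<close> by (intro mult_left_mono m) auto
    finally show ?thesis .
  qed
  then show ?thesis
    using \<open>m > 0\<close> \<open>C > 0\<close> by (intro exI[of _ "C / m"]) simp
qed

lemma le_polar_function_mult_gauge:
  fixes \<gamma> :: "'a::real_vector \<Rightarrow> real"
  assumes "generalized_Minkowski_space \<gamma>" and "linear \<phi>"
  shows "\<phi> x \<le> polar_function \<gamma> \<phi> * \<gamma> x"
proof (cases "\<gamma> x = 0")
  case True
  then have "x = 0"
    using assms(1) gauge_eq_0D by (auto simp: generalized_Minkowski_space_def)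
  then show ?thesis
    using True linear_0[OF assms(2)] by simp
next
  case False
  then have pos: "\<gamma> x > 0"
    using assms(1) gauge_nonneg[of \<gamma> x] by (auto simp: generalized_Minkowski_space_def)
  have "\<phi> x / \<gamma> x \<le> polar_function \<gamma> \<phi>"
    unfolding polar_function_def using linear_le_gauge[OF assms] pos
    by (intro cInf_greatest) (auto simp: pos_divide_le_eq)
  then show ?thesis
    using pos by (simp add: pos_divide_le_eq)
qed

section \<open>The Fermat--Torricelli locus\<close>

lemma mem_norming_cone_iff: "y \<in> norming_cone \<gamma> x \<phi> \<longleftrightarrow> \<phi> (x - y) = \<gamma> (x - y)"
proof
  assume "\<phi> (x - y) = \<gamma> (x - y)"
  then show "y \<in> norming_cone \<gamma> x \<phi>"
    unfolding norming_cone_def by (intro image_eqI[of _ _ "x - y"]) auto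
qed (auto simp: norming_cone_def)

theorem proposition3p2:
  fixes \<gamma> :: "'a::real_vector \<Rightarrow> real"
    and n :: nat
    and p :: "nat \<Rightarrow> 'a"
    and P :: "'a set"
    and xbar :: 'a
    and \<phi> :: "nat \<Rightarrow> 'a \<Rightarrow> real"
  assumes "generalized_Minkowski_space \<gamma>"
    and "n \<ge> 1"
    and "inj_on p {1..n}"
    and "P = p ` {1..n}"
    and "xbar \<in> Fermat_Torricelli_locus \<gamma> P - P"
    and "\<And>i. i \<in> {1..n} \<Longrightarrow> norming_functional \<gamma> (\<phi> i) (p i - xbar)"
    and "\<And>x. (\<Sum>i=1..n. \<phi> i x) = 0"
  shows "Fermat_Torricelli_locus \<gamma> P = (\<Inter>i\<in>{1..n}. norming_cone \<gamma> (p i) (\<phi> i))"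
proof -
  have lin: "linear (\<phi> i)" and norming: "\<phi> i (p i - xbar) = \<gamma> (p i - xbar)"
    if "i \<in> {1..n}" for i
    using assms(6)[OF that] by (auto simp: norming_functional_def)
  have le: "\<phi> i x \<le> \<gamma> x" if "i \<in> {1..n}" for i x
    using le_polar_function_mult_gauge[OF assms(1) lin[OF that], of x] assms(6)[OF that]
    by (simp add: norming_functional_def)
  have objective: "(\<Sum>q\<in>P. \<gamma> (q - y)) = (\<Sum>i=1..n. \<gamma> (p i - y))" for y
    using sum.reindex[OF assms(3)] by (simp add: assms(4))
  define m where "m = (\<Sum>i=1..n. \<phi> i (p i))"
  have m: "(\<Sum>i=1..n. \<phi> i (p i - y)) = m" for y
  proof -
    have "(\<Sum>i=1..n. \<phi> i (p i - y)) = (\<Sum>i=1..n. \<phi> i (p i) - \<phi> i y)"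
      by (intro sum.cong refl linear_diff lin)
    then show ?thesis
      by (simp only: sum_subtractf assms(7) m_def diff_zero)
  qed
  have lower: "m \<le> (\<Sum>i=1..n. \<gamma> (p i - y))" for y
    unfolding m[of y, symmetric] by (intro sum_mono le)
  have attained: "(\<Sum>i=1..n. \<gamma> (p i - xbar)) = m"
    unfolding m[of xbar, symmetric] by (intro sum.cong refl norming[symmetric])
  have "y \<in> Fermat_Torricelli_locus \<gamma> P \<longleftrightarrow> (\<Sum>i=1..n. \<gamma> (p i - y)) = m" for y
    unfolding Fermat_Torricelli_locus_def mem_Collect_eq objective
    using lower attained by (metis order_antisym)
  also have "(\<Sum>i=1..n. \<gamma> (p i - y)) = m \<longleftrightarrow> (\<forall>i\<in>{1..n}. \<phi> i (p i - y) = \<gamma> (p i - y))" for y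
  proof
    assume "(\<Sum>i=1..n. \<gamma> (p i - y)) = m"
    then have "(\<Sum>i=1..n. \<phi> i (p i - y)) = (\<Sum>i=1..n. \<gamma> (p i - y))"
      by (simp only: m)
    then show "\<forall>i\<in>{1..n}. \<phi> i (p i - y) = \<gamma> (p i - y)"
      using le by (intro ballI) (rule sum_mono_inv[of _ "{1..n}"], auto)
  qed (simp add: m[of y, symmetric])
  finally show ?thesis
    by (auto simp: mem_norming_cone_iff)
qed

end
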